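(* The complete graph $K_3$ is a difference graph. Moreover, a set $S$ of positive integers is a signature of $K_3$ if and only if $S=\{a,2a,3a\}$ for some positive integer $a$.
   Context: A graph $G=(V,E)$ is a difference graph if there is a bijection $f$ from $V$ onto a set $S$ of positive integers such that for all distinct $x,y\in V$: $xy\in E$ if and only if $|f(x)-f(y)|\in S$; $S$ is called a signature of $G$. *)

theory Defs
  imports "Graph_Theory.Graph_Theory"
begin

(* Undirected simple graphs are the library's "graph": finite loop-free symmetric
   digraphs without parallel arcs, where xy is an edge iff (x, y) is in arcs_ends G.
   Positive integers are taken in int so that the absolute difference is not
   affected by truncated subtraction. *)

definition is_signature :: "('a, 'b) pre_digraph \<Rightarrow> int set \<Rightarrow> bool" where
  "is_signature G S \<longleftrightarrow> graph G \<and> (\<forall>s\<in>S. 0 < s) \<and>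
     (\<exists>f. bij_betw f (verts G) S \<and>
       (\<forall>x\<in>verts G. \<forall>y\<in>verts G. x \<noteq> y \<longrightarrow> (x \<rightarrow>\<^bsub>G\<^esub> y \<longleftrightarrow> \<bar>f x - f y\<bar> \<in> S)))"

definition difference_graph :: "('a, 'b) pre_digraph \<Rightarrow> bool" where
  "difference_graph G \<longleftrightarrow> (\<exists>S. is_signature G S)"

end

theory Submission
  imports Defs
begin

text \<open>On a complete graph the edge condition only says that \<open>S\<close> is closed under absolute
  differences of distinct elements. If \<open>S = {a, b, c}\<close> with \<open>a < b < c\<close> is positive, then
  \<open>b - a\<close> lies in \<open>S\<close> below \<open>b\<close>, so it is \<open>a\<close>; and \<open>c - b < c - a\<close> both lie in \<open>S\<close> below
  \<open>c\<close>, so they are \<open>a\<close> and \<open>b\<close>.\<close>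

text \<open>All distinct vertices are adjacent, so the labelling drops out of the edge condition:
  any bijection from the vertices onto \<open>S\<close> serves.\<close>

lemma is_signature_complete_iff:
  fixes G :: "('a, 'b) pre_digraph"
  assumes "K\<^bsub>n\<^esub> G" and "0 < n"
  shows "is_signature G S \<longleftrightarrow>
    card S = n \<and> (\<forall>s\<in>S. 0 < s) \<and> (\<forall>s\<in>S. \<forall>t\<in>S. s \<noteq> t \<longrightarrow> \<bar>s - t\<bar> \<in> S)"
proof
  have adj: "x \<rightarrow>\<^bsub>G\<^esub> y" if "x \<in> verts G" "y \<in> verts G" "x \<noteq> y" for x y
    using assms(1) that by (auto simp: complete_digraph_def)
  have card: "card (verts G) = n" and "graph G"
    using assms(1) by (auto simp: complete_digraph_def)
  {
    assume "is_signature G S"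
    then obtain f where pos: "\<forall>s\<in>S. 0 < s" and f: "bij_betw f (verts G) S"
      and "\<forall>x\<in>verts G. \<forall>y\<in>verts G. x \<noteq> y \<longrightarrow> (x \<rightarrow>\<^bsub>G\<^esub> y \<longleftrightarrow> \<bar>f x - f y\<bar> \<in> S)"
      unfolding is_signature_def by blast
    with adj have "\<forall>x\<in>verts G. \<forall>y\<in>verts G. x \<noteq> y \<longrightarrow> \<bar>f x - f y\<bar> \<in> S"
      by blast
    \<comment> \<open>Distinct labels come from distinct vertices, so the condition passes to the
      image, which is \<open>S\<close>.\<close>
    then have "\<forall>s\<in>f ` verts G. \<forall>t\<in>f ` verts G. s \<noteq> t \<longrightarrow> \<bar>s - t\<bar> \<in> S"
      by auto
    with f pos card show "card S = n \<and> (\<forall>s\<in>S. 0 < s) \<and>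
        (\<forall>s\<in>S. \<forall>t\<in>S. s \<noteq> t \<longrightarrow> \<bar>s - t\<bar> \<in> S)"
      by (metis bij_betw_imp_surj_on bij_betw_same_card)
  next
    assume S: "card S = n \<and> (\<forall>s\<in>S. 0 < s) \<and> (\<forall>s\<in>S. \<forall>t\<in>S. s \<noteq> t \<longrightarrow> \<bar>s - t\<bar> \<in> S)"
    \<comment> \<open>\<open>card\<close> is 0 on infinite sets, so \<open>0 < n\<close> yields the
      finiteness needed to get a bijection from equal cardinalities.\<close>
    with card assms(2) have "finite (verts G)" "finite S"
      by (auto intro: card_ge_0_finite)
    with S card obtain f where f: "bij_betw f (verts G) S"
      by (metis finite_same_card_bij)
    \<comment> \<open>Injectivity of \<open>f\<close> gives \<open>f x\<close> \<noteq>
      \<open>f y\<close>, so closure of \<open>S\<close> applies.\<close>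
    have "\<bar>f x - f y\<bar> \<in> S" if "x \<in> verts G" "y \<in> verts G" "x \<noteq> y" for x y
      using S f that by (metis bij_betw_apply bij_betw_imp_inj_on inj_on_contraD)
    with f S adj \<open>graph G\<close> show "is_signature G S"
      unfolding is_signature_def by blast
  }
qed

lemma card_3_linorder:
  fixes S :: "'a :: linorder set"
  assumes "card S = 3"
  obtains a b c where "a < b" "b < c" "S = {a, b, c}"
proof -
  obtain x y z where "S = {x, y, z}" "x \<noteq> y" "y \<noteq> z" "x \<noteq> z"
    using assms by (auto simp: card_3_iff)
  then show thesis
    using that by (metis insert_commute linorder_neqE)
qed

lemma abs_diff_closed_card_3_iff:
  fixes S :: "'a :: linordered_idom set"
  shows "card S = 3 \<and> (\<forall>s\<in>S. 0 < s) \<and> (\<forall>s\<in>S. \<forall>t\<in>S. s \<noteq> t \<longrightarrow> \<bar>s - t\<bar> \<in> S)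
    \<longleftrightarrow> (\<exists>a. 0 < a \<and> S = {a, 2 * a, 3 * a})"
proof
  assume S: "card S = 3 \<and> (\<forall>s\<in>S. 0 < s) \<and> (\<forall>s\<in>S. \<forall>t\<in>S. s \<noteq> t \<longrightarrow> \<bar>s - t\<bar> \<in> S)"
  then obtain a b c where ord: "a < b" "b < c" and abc: "S = {a, b, c}"
    using card_3_linorder by metis
  with S have "0 < a" by simp
  have diff: "t - s \<in> S" if "s \<in> S" "t \<in> S" "s < t" for s t
    using S that by (metis abs_minus_commute abs_of_pos diff_gt_0_iff_gt less_irrefl)
  have "b - a \<in> {a, b, c}" "c - b \<in> {a, b, c}" "c - a \<in> {a, b, c}"
    using diff[of a b] diff[of b c] diff[of a c] ord abc by auto
  with ord \<open>0 < a\<close> have "b = 2 * a" "c = 3 * a" by auto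
  with \<open>0 < a\<close> abc show "\<exists>a. 0 < a \<and> S = {a, 2 * a, 3 * a}" by blast
next
  assume "\<exists>a. 0 < a \<and> S = {a, 2 * a, 3 * a}"
  \<comment> \<open>Up to sign, distinct elements differ by \<open>a\<close> or
    \<open>2 * a\<close>.\<close>
  then show "card S = 3 \<and> (\<forall>s\<in>S. 0 < s) \<and> (\<forall>s\<in>S. \<forall>t\<in>S. s \<noteq> t \<longrightarrow> \<bar>s - t\<bar> \<in> S)"
    by (auto simp: abs_if)
qed

theorem theorem3p1:
  fixes G :: "('a, 'b) pre_digraph"
  assumes "K\<^bsub>3\<^esub> G"
  shows "difference_graph G \<and>
    (\<forall>S. is_signature G S \<longleftrightarrow> (\<exists>a. 0 < a \<and> S = {a, 2 * a, 3 * a}))"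
proof -
  have sig: "is_signature G S \<longleftrightarrow> (\<exists>a. 0 < a \<and> S = {a, 2 * a, 3 * a})" for S
    using is_signature_complete_iff[OF assms, of S] abs_diff_closed_card_3_iff[of S] by simp
  \<comment> \<open>The case \<open>a = 1\<close>, left unevaluated to match the shape
    \<open>{a, 2 * a, 3 * a}\<close> literally.\<close>
  then have "is_signature G {1, 2 * 1, 3 * 1}"
    by (metis zero_less_one)
  with sig show ?thesis
    unfolding difference_graph_def by blast
qed

end
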